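(* Let $A=[a_{ij}]\in\mathbb{C}^{n\times n}$ be an irreducible (row) diagonally dominant matrix. Then $A$ is singular if and only if both of the following conditions hold: (1) $A$ is weakly (row) diagonally dominant; and (2) there exist unit complex numbers $\gamma_1=e^{i\theta(\gamma_1)},\dots,\gamma_n=e^{i\theta(\gamma_n)}$ (in particular nonzero), with real arguments $\theta(\gamma_1),\dots,\theta(\gamma_n)$, which solve the system of angle equations indexed by the nonzero off-diagonal entries of $A$: $$\bmod\bigl(-\theta(\gamma_i)+\theta(\gamma_j),2\pi\bigr)=\bmod\bigl(\pi+\theta(a_{ii})-\theta(a_{ij}),2\pi\bigr)\qquad\text{for all } i,j \text{ with } j\neq i,\ a_{ij}\neq 0,$$ or equivalently $$\bmod\bigl(\theta(\gamma_j),2\pi\bigr)=\bmod\bigl(\pi+\theta(a_{ii})-\theta(a_{ij})+\theta(\gamma_i),2\pi\bigr)\qquad\text{for all } i,j \text{ with } j\neq i,\ a_{ij}\neq 0.$$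
   Context: A matrix $A=[a_{ij}]\in\mathbb{C}^{n\times n}$ is (row) diagonally dominant if $|a_{ii}|\ge\sum_{j\ne i}|a_{ij}|$ for every $i=1,\dots,n$; it is weakly (row) diagonally dominant if $|a_{ii}|=\sum_{j\ne i}|a_{ij}|$ for every $i$. The associated directed graph of $A$ has vertices $v_1,\dots,v_n$ and an edge $(v_i,v_j)$ exactly when $a_{ij}\ne0$; $A$ is irreducible if this graph is strongly connected, i.e. every vertex is reachable from every other vertex. For a nonzero complex number $a$, $\theta(a)$ denotes its argument, so $a=|a|e^{i\theta(a)}$. For real $x$, $\bmod(x,2\pi)\in[0,2\pi)$ is the remainder of $x$ upon division by $2\pi$. *)

theory Defs
  imports
    "HOL-Analysis.Analysis"
    "HOL-Library.Real_Mod"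
    "Graph_Theory.Digraph_Component"
begin

definition row_diag_dominant :: "complex^'n^'n \<Rightarrow> bool" where
  "row_diag_dominant A \<longleftrightarrow> (\<forall>i. cmod (A $ i $ i) \<ge> (\<Sum>j\<in>UNIV - {i}. cmod (A $ i $ j)))"

text \<open>In this convention, weak dominance is equality in \<^emph>\<open>every\<close> row, so it is the stronger of the
  two properties.\<close>

definition weakly_row_diag_dominant :: "complex^'n^'n \<Rightarrow> bool" where
  "weakly_row_diag_dominant A \<longleftrightarrow>
     (\<forall>i. cmod (A $ i $ i) = (\<Sum>j\<in>UNIV - {i}. cmod (A $ i $ j)))"

definition assoc_digraph :: "complex^'n^'n \<Rightarrow> 'n pair_pre_digraph" where
  "assoc_digraph A = \<lparr>pverts = UNIV, parcs = {(i, j). A $ i $ j \<noteq> 0}\<rparr>"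

text \<open>Reachability is reflexive, so every \<open>1 \<times> 1\<close> matrix is irreducible, including the zero one.\<close>

definition irreducible_matrix :: "complex^'n^'n \<Rightarrow> bool" where
  "irreducible_matrix A \<longleftrightarrow> strongly_connected (with_proj (assoc_digraph A))"

text \<open>In the two systems below, \<open>\<theta>\<close> assigns an argument to each nonzero complex number; its value at
  \<open>0\<close> is never relevant for irreducible diagonally dominant \<open>A\<close>, since a row with a nonzero
  off-diagonal entry then has a nonzero diagonal entry.\<close>

definition angle_system :: "(complex \<Rightarrow> real) \<Rightarrow> complex^'n^'n \<Rightarrow> ('n \<Rightarrow> complex) \<Rightarrow> bool" where
  "angle_system \<theta> A \<gamma> \<longleftrightarrow>
     (\<forall>i j. j \<noteq> i \<and> A $ i $ j \<noteq> 0 \<longrightarrow>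
        (- \<theta> (\<gamma> i) + \<theta> (\<gamma> j)) rmod (2 * pi) =
        (pi + \<theta> (A $ i $ i) - \<theta> (A $ i $ j)) rmod (2 * pi))"

definition angle_system' :: "(complex \<Rightarrow> real) \<Rightarrow> complex^'n^'n \<Rightarrow> ('n \<Rightarrow> complex) \<Rightarrow> bool" where
  "angle_system' \<theta> A \<gamma> \<longleftrightarrow>
     (\<forall>i j. j \<noteq> i \<and> A $ i $ j \<noteq> 0 \<longrightarrow>
        \<theta> (\<gamma> j) rmod (2 * pi) =
        (pi + \<theta> (A $ i $ i) - \<theta> (A $ i $ j) + \<theta> (\<gamma> i)) rmod (2 * pi))"

end

theory Submission
  imports Defs
begin

text \<open>
  Each angle equation is the logarithm of a multiplicative one: if \<open>A $ i $ j \<noteq> 0\<close> and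
  \<open>i \<noteq> j\<close>, both forms of the system say that \<open>A $ i $ j * \<gamma> j\<close> points in the direction opposite
  to \<open>A $ i $ i * \<gamma> i\<close>. The off-diagonal terms of row \<open>i\<close> of \<open>A \<gamma>\<close> are thus parallel, so nothing
  cancels among them, and their sum has modulus \<open>\<Sum>j\<noteq>i. cmod (A $ i $ j)\<close>. Equality in the dominance
  condition is then exactly what makes it cancel against the diagonal term, so \<open>\<gamma>\<close> is a nonzero
  kernel vector (\<open>phase_aligned_in_kernel\<close>).

  Conversely, let \<open>A x = 0\<close> with \<open>x \<noteq> 0\<close>, and look at a row \<open>i\<close> where \<open>cmod (x $ i)\<close> is maximal.
  Row \<open>i\<close> of \<open>A x = 0\<close>, the triangle inequality, maximality and dominance form a chain of
  inequalities that starts and ends at \<open>cmod (A $ i $ i) * cmod (x $ i)\<close>, so each one is an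
  equality (\<open>extremal_row\<close>). Equality in dominance is weak dominance of row \<open>i\<close>; equality in the
  triangle inequality makes the off-diagonal terms parallel to their sum \<open>- A $ i $ i * x $ i\<close>, which
  gives the angle equations of row \<open>i\<close>; and equality in the maximality step
  shows that every out-neighbour of \<open>i\<close> is again a maximal index. By strong connectivity every index is maximal, so both conditions hold in all rows, with
  \<open>\<gamma> i = sgn (x $ i)\<close>.
\<close>

section \<open>Angle equations as alignment of phases\<close>

definition phase_aligned :: "complex^'n^'n \<Rightarrow> ('n \<Rightarrow> complex) \<Rightarrow> bool" where
  "phase_aligned A \<gamma> \<longleftrightarrow>
     (\<forall>i j. j \<noteq> i \<and> A $ i $ j \<noteq> 0 \<longrightarrow> sgn (A $ i $ j) * \<gamma> j = - (sgn (A $ i $ i) * \<gamma> i))"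

lemma is_Arg_imp_sgn_eq_cis:
  assumes "is_Arg z r" "z \<noteq> 0"
  shows "sgn z = cis r"
proof -
  have "z = of_real (cmod z) * cis r"
    using assms(1) by (simp add: is_Arg_def cis_conv_exp)
  then show ?thesis
    using assms(2) by (metis nonzero_mult_div_cancel_left norm_eq_zero of_real_eq_0_iff sgn_eq)
qed

lemma diag_nonzero_if_off_diag_nonzero:
  assumes "row_diag_dominant A" "j \<noteq> i" "A $ i $ j \<noteq> 0"
  shows "A $ i $ i \<noteq> 0"
proof -
  have "0 < cmod (A $ i $ j)"
    using assms by simp
  also have "\<dots> \<le> (\<Sum>k\<in>UNIV - {i}. cmod (A $ i $ k))"
    using assms by (intro member_le_sum) auto
  also have "\<dots> \<le> cmod (A $ i $ i)"
    using assms by (simp add: row_diag_dominant_def)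
  finally show ?thesis by simp
qed

text \<open>
  Exponentiating turns a congruence modulo \<open>2 * pi\<close> into an equation between unit complex numbers,
  the summand \<open>pi\<close> becoming a sign. The two systems differ only by the term \<open>\<theta> (\<gamma> i)\<close>, which may be
  moved across the congruence, so both become the same equation.
\<close>

lemma angle_systems_iff_phase_aligned:
  fixes A :: "complex^'n^'n" and \<theta> :: "complex \<Rightarrow> real"
  assumes arg: "\<And>z. z \<noteq> 0 \<Longrightarrow> is_Arg z (\<theta> z)"
    and dom: "row_diag_dominant A"
    and unit: "\<And>i. cmod (\<gamma> i) = 1"
  shows "angle_system \<theta> A \<gamma> \<longleftrightarrow> phase_aligned A \<gamma>"
    and "angle_system' \<theta> A \<gamma> \<longleftrightarrow> phase_aligned A \<gamma>"
proof -
  have cis_\<theta>: "cis (\<theta> z) = sgn z" if "z \<noteq> 0" for z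
    using is_Arg_imp_sgn_eq_cis arg that by metis
  have cis_\<gamma>: "cis (\<theta> (\<gamma> i)) = \<gamma> i" for i
    using cis_\<theta>[of "\<gamma> i"] unit[of i] by (cases "\<gamma> i = 0") (simp_all add: sgn_eq)
  have rmod_iff: "a rmod (2 * pi) = b rmod (2 * pi) \<longleftrightarrow> cis a = cis b" for a b
    by (simp add: cis_eq_iff rcong_def)
  have eqs:
    "(- \<theta> (\<gamma> i) + \<theta> (\<gamma> j)) rmod (2 * pi) = (pi + \<theta> (A $ i $ i) - \<theta> (A $ i $ j)) rmod (2 * pi)
      \<longleftrightarrow> sgn (A $ i $ j) * \<gamma> j = - (sgn (A $ i $ i) * \<gamma> i)"
    "\<theta> (\<gamma> j) rmod (2 * pi) =
       (pi + \<theta> (A $ i $ i) - \<theta> (A $ i $ j) + \<theta> (\<gamma> i)) rmod (2 * pi)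
      \<longleftrightarrow> sgn (A $ i $ j) * \<gamma> j = - (sgn (A $ i $ i) * \<gamma> i)"
    if "j \<noteq> i" "A $ i $ j \<noteq> 0" for i j
  proof -
    have "A $ i $ i \<noteq> 0"
      using diag_nonzero_if_off_diag_nonzero[OF dom that] .
    moreover have "\<gamma> i \<noteq> 0" "sgn (A $ i $ j) \<noteq> 0"
      using unit[of i] that by (auto simp: sgn_zero_iff)
    ultimately show
      "(- \<theta> (\<gamma> i) + \<theta> (\<gamma> j)) rmod (2 * pi) = (pi + \<theta> (A $ i $ i) - \<theta> (A $ i $ j)) rmod (2 * pi)
        \<longleftrightarrow> sgn (A $ i $ j) * \<gamma> j = - (sgn (A $ i $ i) * \<gamma> i)"
      "\<theta> (\<gamma> j) rmod (2 * pi) =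
         (pi + \<theta> (A $ i $ i) - \<theta> (A $ i $ j) + \<theta> (\<gamma> i)) rmod (2 * pi)
        \<longleftrightarrow> sgn (A $ i $ j) * \<gamma> j = - (sgn (A $ i $ i) * \<gamma> i)"
      unfolding rmod_iff using that(2)
      by (auto simp: cis_mult[symmetric] cis_divide[symmetric] cis_inverse[symmetric]
          cis_\<theta> cis_\<gamma> field_simps)
  qed
  show "angle_system \<theta> A \<gamma> \<longleftrightarrow> phase_aligned A \<gamma>"
    unfolding angle_system_def phase_aligned_def using eqs(1) by blast
  show "angle_system' \<theta> A \<gamma> \<longleftrightarrow> phase_aligned A \<gamma>"
    unfolding angle_system'_def phase_aligned_def using eqs(2) by blast
qed

section \<open>Aligned phases give a kernel vector\<close>

lemma matrix_vector_mult_split_diag: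
  fixes A :: "'a::comm_semiring_1^'n^'n"
  shows "(A *v x) $ i = A $ i $ i * x $ i + (\<Sum>j\<in>UNIV - {i}. A $ i $ j * x $ j)"
  by (simp add: matrix_vector_mult_def sum.remove[of UNIV i])

lemma phase_aligned_in_kernel:
  fixes A :: "complex^'n^'n"
  assumes weak: "weakly_row_diag_dominant A" and aligned: "phase_aligned A \<gamma>"
  shows "A *v (\<chi> i. \<gamma> i) = 0"
proof -
  have polar: "of_real (cmod z) * sgn z = z" for z :: complex
    by (simp add: sgn_eq)
  have "(A *v (\<chi> i. \<gamma> i)) $ i = 0" for i
  proof -
    have "A $ i $ j * \<gamma> j = of_real (cmod (A $ i $ j)) * - (sgn (A $ i $ i) * \<gamma> i)"
      if "j \<noteq> i" for j
    proof (cases "A $ i $ j = 0")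
      case False
      then have "sgn (A $ i $ j) * \<gamma> j = - (sgn (A $ i $ i) * \<gamma> i)"
        using aligned that by (simp add: phase_aligned_def)
      then show ?thesis
        by (metis mult.assoc polar)
    qed simp
    then have "(\<Sum>j\<in>UNIV - {i}. A $ i $ j * \<gamma> j)
        = (\<Sum>j\<in>UNIV - {i}. of_real (cmod (A $ i $ j)) * - (sgn (A $ i $ i) * \<gamma> i))"
      by (intro sum.cong) auto
    also have "\<dots> = of_real (\<Sum>j\<in>UNIV - {i}. cmod (A $ i $ j)) * - (sgn (A $ i $ i) * \<gamma> i)"
      by (simp only: sum_distrib_right of_real_sum)
    also have "\<dots> = of_real (cmod (A $ i $ i)) * - (sgn (A $ i $ i) * \<gamma> i)"
      using weak by (simp add: weakly_row_diag_dominant_def)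
    also have "\<dots> = - (A $ i $ i * \<gamma> i)"
      by (metis mult.assoc mult_minus_right polar)
    finally show ?thesis
      by (simp add: matrix_vector_mult_split_diag)
  qed
  then show ?thesis
    by (simp add: vec_eq_iff)
qed

section \<open>Kernel vectors of irreducible dominant matrices\<close>

text \<open>
  Pairing every term with the total \<open>s\<close> shows it: \<open>f i \<bullet> s \<le> norm (f i) * norm s\<close>, and both sides
  sum to \<open>(norm s)\<^sup>2\<close>, so Cauchy-Schwarz is an equality for every term.
\<close>

lemma norm_sum_eq_imp_parallel:
  fixes f :: "'i \<Rightarrow> 'a::real_inner"
  assumes fin: "finite I" and i: "i \<in> I"
    and eq: "norm (sum f I) = (\<Sum>i\<in>I. norm (f i))"
  shows "norm (f i) *\<^sub>R sum f I = norm (sum f I) *\<^sub>R f i"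
proof -
  let ?s = "sum f I"
  have "(\<Sum>i\<in>I. f i \<bullet> ?s) = (\<Sum>i\<in>I. norm (f i) * norm ?s)"
    by (simp add: inner_sum_left[symmetric] sum_distrib_right[symmetric] eq[symmetric]
        power2_norm_eq_inner[symmetric] power2_eq_square)
  then have "f i \<bullet> ?s = norm (f i) * norm ?s"
    by (rule sum_mono_inv[OF _ norm_cauchy_schwarz i fin])
  then show ?thesis
    by (simp add: norm_cauchy_schwarz_eq)
qed

text \<open>
  The chain of inequalities
  \<open>cmod (A $ i $ i) * m = cmod (\<Sum>j\<noteq>i. A $ i $ j * x $ j) \<le> (\<Sum>j\<noteq>i. cmod (A $ i $ j) * cmod (x $ j))
   \<le> (\<Sum>j\<noteq>i. cmod (A $ i $ j)) * m \<le> cmod (A $ i $ i) * m\<close>, where \<open>m = cmod (x $ i)\<close>, has equal ends.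
  The three conclusions come from the last, the middle and the first inequality in it.
\<close>

lemma extremal_row:
  fixes A :: "complex^'n^'n"
  assumes dom: "row_diag_dominant A"
    and ker: "(A *v x) $ i = 0"
    and nz: "x $ i \<noteq> 0"
    and max: "\<And>j. cmod (x $ j) \<le> cmod (x $ i)"
  shows "cmod (A $ i $ i) = (\<Sum>j\<in>UNIV - {i}. cmod (A $ i $ j))"
    and "j \<noteq> i \<Longrightarrow> A $ i $ j \<noteq> 0 \<Longrightarrow> cmod (x $ j) = cmod (x $ i)"
    and "j \<noteq> i \<Longrightarrow> A $ i $ j \<noteq> 0 \<Longrightarrow> sgn (A $ i $ j) * x $ j = - (sgn (A $ i $ i) * x $ i)"
proof -
  define m where "m = cmod (x $ i)"
  define I where "I = UNIV - {i}"
  let ?t = "\<lambda>j. A $ i $ j * x $ j"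
  have m: "m > 0"
    using nz by (simp add: m_def)
  have sum_t: "sum ?t I = - (A $ i $ i * x $ i)"
    using ker by (simp add: matrix_vector_mult_split_diag I_def eq_neg_iff_add_eq_0 add.commute)
  have start: "cmod (A $ i $ i) * m = cmod (sum ?t I)"
    by (simp add: sum_t norm_mult m_def)
  have triangle: "cmod (sum ?t I) \<le> (\<Sum>j\<in>I. cmod (?t j))"
    by (rule norm_sum)
  have termwise: "cmod (?t j) \<le> cmod (A $ i $ j) * m" for j
    using max[of j] by (simp add: norm_mult m_def mult_left_mono)
  have maximal: "(\<Sum>j\<in>I. cmod (?t j)) \<le> (\<Sum>j\<in>I. cmod (A $ i $ j) * m)"
    by (rule sum_mono) (rule termwise)
  have dominance: "(\<Sum>j\<in>I. cmod (A $ i $ j) * m) \<le> cmod (A $ i $ i) * m"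
    using dom m by (simp add: row_diag_dominant_def I_def sum_distrib_right[symmetric])
  show "cmod (A $ i $ i) = (\<Sum>j\<in>UNIV - {i}. cmod (A $ i $ j))"
  proof -
    have "cmod (A $ i $ i) * m = (\<Sum>j\<in>I. cmod (A $ i $ j)) * m"
      using start triangle maximal dominance by (simp add: sum_distrib_right)
    then show ?thesis
      using m by (simp add: I_def)
  qed
  assume "j \<noteq> i" and nz_ij: "A $ i $ j \<noteq> 0"
  then have "j \<in> I"
    by (simp add: I_def)
  have "(\<Sum>j\<in>I. cmod (?t j)) = (\<Sum>j\<in>I. cmod (A $ i $ j) * m)"
    using start triangle maximal dominance by linarith
  then have tj: "cmod (?t j) = cmod (A $ i $ j) * m"
    by (rule sum_mono_inv) (use termwise \<open>j \<in> I\<close> in auto)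
  then show "cmod (x $ j) = cmod (x $ i)"
    using nz_ij by (simp add: norm_mult m_def)
  have "cmod (sum ?t I) = (\<Sum>j\<in>I. cmod (?t j))"
    using start triangle maximal dominance by linarith
  then have "cmod (?t j) *\<^sub>R sum ?t I = cmod (sum ?t I) *\<^sub>R ?t j"
    using \<open>j \<in> I\<close> by (intro norm_sum_eq_imp_parallel) auto
  then have "(cmod (A $ i $ j) * m) *\<^sub>R - (A $ i $ i * x $ i) = (cmod (A $ i $ i) * m) *\<^sub>R ?t j"
    unfolding tj start[symmetric] unfolding sum_t .
  then have "of_real m * (of_real (cmod (A $ i $ j)) * - (A $ i $ i * x $ i))
      = of_real m * (of_real (cmod (A $ i $ i)) * ?t j)"
    by (simp add: scaleR_conv_of_real mult_ac)
  then have "of_real (cmod (A $ i $ j)) * - (A $ i $ i * x $ i) = of_real (cmod (A $ i $ i)) * ?t j"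
    by (rule mult_left_cancel[THEN iffD1, rotated]) (use m in simp)
  moreover have "A $ i $ i \<noteq> 0"
    using diag_nonzero_if_off_diag_nonzero[OF dom \<open>j \<noteq> i\<close> nz_ij] .
  ultimately show "sgn (A $ i $ j) * x $ j = - (sgn (A $ i $ i) * x $ i)"
    using nz_ij by (simp add: sgn_eq field_simps)
qed

lemma irreducible_closed_set_eq_UNIV:
  fixes A :: "complex^'n^'n"
  assumes irred: "irreducible_matrix A"
    and start: "i \<in> S"
    and closed: "\<And>i j. i \<in> S \<Longrightarrow> A $ i $ j \<noteq> 0 \<Longrightarrow> j \<in> S"
  shows "S = UNIV"
proof -
  have "k \<in> S" for k
  proof -
    have "(i, k) \<in> rtrancl_on UNIV {(i, j). A $ i $ j \<noteq> 0}"
      using irred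
      by (simp add: irreducible_matrix_def strongly_connected_def reachable_def assoc_digraph_def)
    then show ?thesis
      by (induction rule: rtrancl_on_induct) (use start closed in auto)
  qed
  then show ?thesis by blast
qed

lemma kernel_vector_imp_phase_aligned:
  fixes A :: "complex^'n^'n"
  assumes irred: "irreducible_matrix A" and dom: "row_diag_dominant A"
    and ker: "A *v x = 0" and nz: "x \<noteq> 0"
  shows "weakly_row_diag_dominant A"
    and "\<exists>\<gamma>. (\<forall>i. cmod (\<gamma> i) = 1) \<and> phase_aligned A \<gamma>"
proof -
  define m where "m = Max (range (\<lambda>i. cmod (x $ i)))"
  have le_m: "cmod (x $ i) \<le> m" for i
    by (simp add: m_def)
  obtain k where "x $ k \<noteq> 0"
    using nz by (auto simp: vec_eq_iff)
  then have m: "m > 0"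
    using le_m[of k] by (meson less_le_trans zero_less_norm_iff)
  have "m \<in> range (\<lambda>i. cmod (x $ i))"
    unfolding m_def by (rule Max_in) auto
  then obtain i0 where "cmod (x $ i0) = m"
    by auto
  \<comment> \<open>The edge relation includes loops at nonzero diagonal entries, hence the case \<open>j = i\<close>.\<close>
  moreover have "cmod (x $ j) = m" if "cmod (x $ i) = m" "A $ i $ j \<noteq> 0" for i j
  proof (cases "j = i")
    case False
    then have "cmod (x $ j) = cmod (x $ i)"
      using that m le_m ker by (intro extremal_row(2)[OF dom]) auto
    then show ?thesis
      using that by simp
  qed (use that in simp)
  ultimately have "{i. cmod (x $ i) = m} = UNIV"
    by (intro irreducible_closed_set_eq_UNIV[OF irred, of i0]) auto
  then have norm_x: "cmod (x $ i) = m" for i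
    by auto
  have row: "(A *v x) $ i = 0" "x $ i \<noteq> 0" "cmod (x $ j) \<le> cmod (x $ i)" for i j
    using ker m norm_x[of i] norm_x[of j] by auto
  show "weakly_row_diag_dominant A"
    unfolding weakly_row_diag_dominant_def using extremal_row(1)[OF dom row] by blast
  have "phase_aligned A (\<lambda>i. sgn (x $ i))"
    unfolding phase_aligned_def
  proof (intro allI impI)
    fix i j assume "j \<noteq> i \<and> A $ i $ j \<noteq> 0"
    then have "sgn (A $ i $ j) * x $ j = - (sgn (A $ i $ i) * x $ i)"
      using extremal_row(3)[OF dom row] by blast
    then show "sgn (A $ i $ j) * sgn (x $ j) = - (sgn (A $ i $ i) * sgn (x $ i))"
      using m by (simp add: sgn_eq[of "x $ _"] norm_x field_simps)
  qed
  moreover have "cmod (sgn (x $ i)) = 1" for i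
    using row(2) by (simp add: norm_sgn)
  ultimately show "\<exists>\<gamma>. (\<forall>i. cmod (\<gamma> i) = 1) \<and> phase_aligned A \<gamma>"
    by (intro exI[of _ "\<lambda>i. sgn (x $ i)"]) simp
qed

section \<open>The singularity criterion\<close>

lemma not_invertible_iff_kernel:
  fixes A :: "'a::field^'n^'n"
  shows "\<not> invertible A \<longleftrightarrow> (\<exists>x. x \<noteq> 0 \<and> A *v x = 0)"
  by (auto simp: invertible_left_inverse matrix_left_invertible_ker)

theorem theorem4p1:
  fixes A :: "complex^'n^'n" and \<theta> :: "complex \<Rightarrow> real"
  assumes arg: "\<And>z. z \<noteq> 0 \<Longrightarrow> is_Arg z (\<theta> z)"
    and irred: "irreducible_matrix A"
    and dom: "row_diag_dominant A"
  shows "(\<not> invertible A \<longleftrightarrow>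
            weakly_row_diag_dominant A \<and>
            (\<exists>\<gamma>. (\<forall>i. cmod (\<gamma> i) = 1) \<and> angle_system \<theta> A \<gamma>)) \<and>
         (\<forall>\<gamma>. (\<forall>i. cmod (\<gamma> i) = 1) \<longrightarrow> (angle_system \<theta> A \<gamma> \<longleftrightarrow> angle_system' \<theta> A \<gamma>))"
proof -
  have sys: "angle_system \<theta> A \<gamma> \<longleftrightarrow> phase_aligned A \<gamma>"
    "angle_system' \<theta> A \<gamma> \<longleftrightarrow> phase_aligned A \<gamma>" if "\<forall>i. cmod (\<gamma> i) = 1" for \<gamma>
    using angle_systems_iff_phase_aligned[OF arg dom] that by blast+
  have "\<not> invertible A \<longleftrightarrow> weakly_row_diag_dominant A \<and>
      (\<exists>\<gamma>. (\<forall>i. cmod (\<gamma> i) = 1) \<and> phase_aligned A \<gamma>)"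
  proof
    assume "\<not> invertible A"
    then show "weakly_row_diag_dominant A \<and> (\<exists>\<gamma>. (\<forall>i. cmod (\<gamma> i) = 1) \<and> phase_aligned A \<gamma>)"
      using kernel_vector_imp_phase_aligned[OF irred dom] by (auto simp: not_invertible_iff_kernel)
  next
    assume "weakly_row_diag_dominant A \<and> (\<exists>\<gamma>. (\<forall>i. cmod (\<gamma> i) = 1) \<and> phase_aligned A \<gamma>)"
    then obtain \<gamma> where \<gamma>: "\<And>i. cmod (\<gamma> i) = 1" "A *v (\<chi> i. \<gamma> i) = 0"
      using phase_aligned_in_kernel by blast
    have "(\<chi> i. \<gamma> i) \<noteq> 0"
      using \<gamma>(1) by (metis norm_zero vec_lambda_beta zero_index zero_neq_one)
    then show "\<not> invertible A"
      using \<gamma>(2) not_invertible_iff_kernel by blast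
  qed
  then show ?thesis
    using sys by blast
qed

end
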